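(* Let $c$ be an odd residue class modulo $12$. (1) If $c\equiv1\pmod4$, then for every integer $r\geq2$ the set $$\{s\in\mathbb N: s\equiv c\pmod{12},\ \ell(s)=r\}$$ is the union of exactly $F_{r-1}$ residue classes modulo $12\cdot2^r$. (2) If $c\equiv3\pmod4$, then for every integer $r\geq3$ the set $$\{s\in\mathbb N: s\equiv c\pmod{12},\ \ell(s)=r\}$$ is the union of exactly $F_r-1$ residue classes modulo $12\cdot2^r$.
   Context: $\mathbb N$ denotes the positive integers. The Collatz function $T:\mathbb N\to\mathbb N$ is $T(n)=n/2$ if $n$ is even and $T(n)=(3n+1)/2$ if $n$ is odd; $T^0(s)=s$ and $T^k(s)=T(T^{k-1}(s))$ for $k\geq1$. For odd $s\in\mathbb N$, the cut time is $$\ell(s)=\min\{k\geq1 : T^k(s)\equiv 3\pmod 4 \text{ and } T^{k-1}(s)\text{ is even}\},$$ with $\ell(s)=\infty$ if this set is empty. A residue class modulo $m$ means a set $[a]_m=\{n\in\mathbb N: n\equiv a\pmod m\}$. The Fibonacci numbers are $F_0=0$, $F_1=1$, $F_{m+1}=F_m+F_{m-1}$ for $m\geq1$. *)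

theory Defs
  imports
    "HOL-Library.Extended_Nat"
    "HOL-Number_Theory.Cong"
    "HOL-Number_Theory.Fib"
begin

definition collatz :: "nat \<Rightarrow> nat" where
  "collatz n = (if even n then n div 2 else (3 * n + 1) div 2)"

definition is_cut :: "nat \<Rightarrow> nat \<Rightarrow> bool" where
  "is_cut s k \<longleftrightarrow>
     k \<ge> 1 \<and> [(collatz ^^ k) s = 3] (mod 4) \<and> even ((collatz ^^ (k - 1)) s)"

text \<open>Only the values at odd positive \<open>s\<close> are meaningful.\<close>

definition cut_time :: "nat \<Rightarrow> enat" where
  "cut_time s = (if \<exists>k. is_cut s k then enat (LEAST k. is_cut s k) else \<infinity>)"

text \<open>Residue classes consist of positive integers, so \<open>0\<close> is excluded.\<close>

definition residue_class :: "nat \<Rightarrow> nat \<Rightarrow> nat set" where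
  "residue_class m a = {n. n > 0 \<and> [n = a] (mod m)}"

text \<open>The classes in the union are counted as distinct sets. Finiteness is required because
  \<open>card\<close> of an infinite set is \<open>0\<close>.\<close>

definition union_of_exactly :: "nat set \<Rightarrow> nat \<Rightarrow> nat \<Rightarrow> bool" where
  "union_of_exactly S N m \<longleftrightarrow>
     (\<exists>C. C \<subseteq> range (residue_class m) \<and> finite C \<and> card C = N \<and> S = \<Union>C)"

end

theory Submission
  imports Defs
begin

text \<open>
  A cut at time \<open>k\<close> says that the iterates at times \<open>k - 1\<close>, \<open>k\<close>, \<open>k + 1\<close> are even, odd, odd, so
  \<open>cut_time s = r\<close> depends only on the parities of the first \<open>r + 2\<close> iterates, that is, on
  \<open>s mod 2 ^ (r + 2)\<close>. Since every pair of a parity of \<open>s\<close> and a residue of \<open>collatz s\<close>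
  modulo \<open>2 ^ k\<close> comes from exactly one residue of \<open>s\<close> modulo \<open>2 ^ (k + 1)\<close>, removing the first
  step gives a recursion for the numbers \<open>e r\<close>, \<open>u r\<close>, \<open>v r\<close> of residues \<open>s\<close> with first
  cut at time \<open>r\<close> that are even, \<open>1\<close> modulo \<open>4\<close>, and \<open>3\<close> modulo \<open>4\<close>, respectively:
  \<open>e (r + 1) = e r + u r\<close>, \<open>u (r + 1) = e r\<close>, \<open>v (r + 1) = u r + v r\<close>. The residue modulo \<open>3\<close> is
  independent of all this by the Chinese remainder theorem.
\<close>

subsection \<open>Unions of residue classes\<close>

lemma residue_class_inject:
  assumes "a < m" "b < m" "residue_class m a = residue_class m b"
  shows "a = b"
proof -
  \<comment> \<open>The witness is \<open>a + m\<close>, since \<open>a\<close> may be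
    \<open>0\<close> and then lies in no class.\<close>
  have "a + m \<in> residue_class m a"
    using assms(1) by (simp add: residue_class_def cong_def)
  then have "a + m \<in> residue_class m b"
    using assms(3) by simp
  then show ?thesis
    using assms(1,2) by (simp add: residue_class_def cong_def)
qed

text \<open>Periodicity makes \<open>P\<close> constant on each class, and distinct representatives
  below \<open>m\<close> give distinct classes.\<close>

lemma union_of_exactly_periodic:
  assumes "m > 0" and periodic: "\<And>a. P (a mod m) \<longleftrightarrow> P a"
  shows "union_of_exactly {s. s > 0 \<and> P s} (card {a. a < m \<and> P a}) m"
  unfolding union_of_exactly_def
proof (intro exI conjI)
  let ?A = "{a. a < m \<and> P a}"
  let ?C = "residue_class m ` ?A"
  show "?C \<subseteq> range (residue_class m)" by blast
  show "finite ?C" by simp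
  show "card ?C = card ?A"
    by (intro card_image inj_onI) (auto intro: residue_class_inject)
  show "{s. s > 0 \<and> P s} = \<Union>?C"
  proof (intro set_eqI iffI)
    fix s assume "s \<in> {s. s > 0 \<and> P s}"
    then have "s mod m \<in> ?A" "s \<in> residue_class m (s mod m)"
      using assms by (auto simp: residue_class_def cong_def)
    then show "s \<in> \<Union>?C" by blast
  next
    fix s assume "s \<in> \<Union>?C"
    then obtain a where "a < m" "P a" "s > 0" "s mod m = a mod m"
      by (auto simp: residue_class_def cong_def)
    then show "s \<in> {s. s > 0 \<and> P s}"
      using periodic[of s] by simp
  qed
qed

text \<open>By the Chinese remainder theorem, reduction modulo \<open>n\<close> is a bijection
  between the two sets.\<close>

lemma card_cong_periodic:
  fixes m n :: nat
  assumes "coprime m n" "m > 0" "n > 0" and periodic: "\<And>a. P (a mod n) \<longleftrightarrow> P a"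
  shows "card {a. a < m * n \<and> [a = c] (mod m) \<and> P a} = card {a. a < n \<and> P a}"
proof -
  have "bij_betw (\<lambda>a. a mod n) {a. a < m * n \<and> [a = c] (mod m) \<and> P a} {a. a < n \<and> P a}"
  proof (rule bij_betwI')
    fix a b
    assume a: "a \<in> {a. a < m * n \<and> [a = c] (mod m) \<and> P a}"
      and b: "b \<in> {a. a < m * n \<and> [a = c] (mod m) \<and> P a}"
    show "(a mod n = b mod n) = (a = b)"
    proof
      assume "a mod n = b mod n"
      moreover have "[a = b] (mod m)"
        using a b by (auto intro: cong_trans cong_sym)
      ultimately have "[a = b] (mod m * n)"
        using assms(1) by (simp add: coprime_cong_mult_nat cong_def[of a b n])
      then show "a = b"
        using a b by (simp add: cong_def)
    qed simp
  next
    fix a assume "a \<in> {a. a < m * n \<and> [a = c] (mod m) \<and> P a}"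
    then show "a mod n \<in> {a. a < n \<and> P a}"
      using assms(3) periodic by simp
  next
    fix b assume b: "b \<in> {a. a < n \<and> P a}"
    obtain a where a: "a < m * n" "[a = c] (mod m)" "[a = b] (mod n)"
      using binary_chinese_remainder_unique_nat[of m n c b] assms(1-3) by auto
    then have "a mod n = b"
      using b by (simp add: cong_def)
    then show "\<exists>a \<in> {a. a < m * n \<and> [a = c] (mod m) \<and> P a}. b = a mod n"
      using a b periodic[of a] by auto
  qed
  then show ?thesis by (rule bij_betw_same_card)
qed

subsection \<open>The Collatz map modulo powers of two\<close>

lemma collatz_double: "collatz (2 * j) = j"
  by (simp add: collatz_def)

lemma collatz_double_Suc: "collatz (Suc (2 * j)) = 3 * j + 2"
  by (simp add: collatz_def)

lemma cong_collatz:
  assumes "[a = b] (mod 2 ^ Suc k)"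
  shows "[collatz a = collatz b] (mod 2 ^ k)"
proof -
  have "even a \<longleftrightarrow> even b"
    using cong_dvd_modulus_nat[OF assms, of 2] by (auto simp: cong_def even_iff_mod_2_eq_zero)
  then consider i j where "a = 2 * i" "b = 2 * j" | i j where "a = 2 * i + 1" "b = 2 * j + 1"
    by (metis evenE oddE)
  then show ?thesis
  proof cases
    case 1
    then show ?thesis
      using assms by (simp add: collatz_double cong_def mult_mod_right[symmetric])
  next
    case 2
    then have "[2 * i = 2 * j] (mod 2 * 2 ^ k)"
      using assms by (simp add: cong_add_rcancel_nat flip: add_Suc_right)
    then have "[i = j] (mod 2 ^ k)"
      by (simp add: cong_def mult_mod_right[symmetric])
    then show ?thesis
      unfolding 2 Suc_eq_plus1[symmetric] collatz_double_Suc by (intro cong_add cong_mult) simp_all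
  qed
qed

lemma card_even_collatz:
  "card {a. a < 2 ^ Suc k \<and> even a \<and> P (collatz a)} = card {b. b < 2 ^ k \<and> P b}"
proof -
  have "{a. a < 2 ^ Suc k \<and> even a \<and> P (collatz a)} = (\<lambda>b. 2 * b) ` {b. b < 2 ^ k \<and> P b}"
    by (auto simp: collatz_double elim!: evenE)
  then show ?thesis
    by (simp add: card_image inj_on_def)
qed

text \<open>The odd number \<open>2 * j + 1\<close> is sent to \<open>3 * j + 2\<close>, and
  \<open>j \<mapsto> 3 * j + 2\<close> permutes the residues modulo \<open>2 ^ k\<close> because
  \<open>3\<close> is invertible there. Periodicity allows \<open>3 * j + 2\<close>, which may
  exceed \<open>2 ^ k\<close>, to be reduced.\<close>

lemma card_odd_collatz:
  assumes periodic: "\<And>a. P (a mod 2 ^ k) \<longleftrightarrow> P a"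
  shows "card {a. a < 2 ^ Suc k \<and> odd a \<and> P (collatz a)} = card {b. b < 2 ^ k \<and> P b}"
proof -
  let ?f = "\<lambda>j::nat. (3 * j + 2) mod 2 ^ k"
  have "inj_on ?f {..<2 ^ k}"
  proof (rule inj_onI)
    fix i j :: nat
    assume ij: "i \<in> {..<2 ^ k}" "j \<in> {..<2 ^ k}" and "?f i = ?f j"
    then have "[3 * i = 3 * j] (mod 2 ^ k)"
      by (simp only: cong_add_rcancel_nat flip: cong_def)
    moreover have "coprime (3::nat) (2 ^ k)" by simp
    ultimately have "[i = j] (mod 2 ^ k)"
      by (simp add: cong_mult_lcancel_nat)
    then show "i = j"
      using ij by (simp add: cong_def)
  qed
  moreover from this have "?f ` {..<2 ^ k} = {..<2 ^ k}"
    by (intro endo_inj_surj) auto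
  ultimately have "bij_betw ?f {..<2 ^ k} {..<2 ^ k}"
    by (rule bij_betw_imageI)
  then have "bij_betw ?f {j \<in> {..<2 ^ k}. P (?f j)} {b \<in> {..<2 ^ k}. P b}"
    by (rule bij_betw_Collect) (rule refl)
  then have "card {j \<in> {..<2 ^ k}. P (?f j)} = card {b \<in> {..<2 ^ k}. P b}"
    by (rule bij_betw_same_card)
  then have "card {j. j < 2 ^ k \<and> P (3 * j + 2)} = card {b. b < 2 ^ k \<and> P b}"
    by (simp only: periodic lessThan_iff)
  moreover have "{a. a < 2 ^ Suc k \<and> odd a \<and> P (collatz a)}
      = (\<lambda>j. 2 * j + 1) ` {j. j < 2 ^ k \<and> P (3 * j + 2)}"
    by (auto simp: collatz_double_Suc elim!: oddE)
  ultimately show ?thesis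
    by (simp add: card_image inj_on_def)
qed

subsection \<open>Counting residues by first cut\<close>

text \<open>This form avoids \<open>LEAST\<close> and \<open>enat\<close>, so that the first Collatz
  step can be split off.\<close>

definition first_cut :: "nat \<Rightarrow> nat \<Rightarrow> bool" where
  "first_cut r s \<longleftrightarrow> is_cut s r \<and> (\<forall>k<r. \<not> is_cut s k)"

lemma cut_time_eq_enat_iff: "cut_time s = enat r \<longleftrightarrow> first_cut r s"
proof
  assume "cut_time s = enat r"
  then have "\<exists>k. is_cut s k" "r = (LEAST k. is_cut s k)"
    by (auto simp: cut_time_def split: if_splits)
  then show "first_cut r s"
    unfolding first_cut_def by (metis LeastI_ex not_less_Least)
next
  assume "first_cut r s"
  then have "is_cut s r" "(LEAST k. is_cut s k) = r"
    unfolding first_cut_def by (auto intro!: Least_equality simp: not_less[symmetric])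
  then show "cut_time s = enat r"
    by (auto simp: cut_time_def)
qed

lemma not_is_cut_0: "\<not> is_cut s 0"
  by (simp add: is_cut_def)

lemma is_cut_1: "is_cut s (Suc 0) \<longleftrightarrow> even s \<and> collatz s mod 4 = 3"
  by (auto simp: is_cut_def cong_def)

lemma is_cut_Suc_Suc: "is_cut s (Suc (Suc k)) \<longleftrightarrow> is_cut (collatz s) (Suc k)"
  by (simp add: is_cut_def funpow_Suc_right del: funpow.simps)

lemma first_cut_1: "first_cut (Suc 0) s \<longleftrightarrow> even s \<and> collatz s mod 4 = 3"
  by (simp add: first_cut_def is_cut_1 not_is_cut_0)

lemma first_cut_1_iff: "first_cut (Suc 0) s \<longleftrightarrow> s mod 8 = 6"
  unfolding first_cut_1 collatz_def by presburger

text \<open>A cut at time \<open>1\<close> involves the parity of \<open>s\<close> itself, so it is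
  tested separately; every later cut of \<open>s\<close> is a cut of \<open>collatz s\<close> one
  step earlier.\<close>

lemma first_cut_Suc_Suc:
  "first_cut (Suc (Suc n)) s \<longleftrightarrow>
     \<not> (even s \<and> collatz s mod 4 = 3) \<and> first_cut (Suc n) (collatz s)"
  by (auto simp: first_cut_def All_less_Suc2 is_cut_1 is_cut_Suc_Suc not_is_cut_0)

text \<open>A cut at time \<open>1\<close> is decided modulo \<open>8\<close>, and each further
  Collatz step costs one factor of two.\<close>

lemma first_cut_cong:
  "[a = b] (mod 2 ^ (n + 3)) \<Longrightarrow> first_cut (Suc n) a \<longleftrightarrow> first_cut (Suc n) b"
proof (induction n arbitrary: a b)
  case 0
  then have "[collatz a = collatz b] (mod 2 ^ 2)" "[a = b] (mod 2)"
    using cong_collatz[of a b 2] cong_dvd_modulus_nat[OF 0, of 2]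
    by (simp_all add: numeral_3_eq_3)
  then show ?case
    by (auto simp: first_cut_1 cong_def even_iff_mod_2_eq_zero)
next
  case (Suc n)
  then have collatz: "[collatz a = collatz b] (mod 2 ^ (n + 3))"
    using cong_collatz[of a b "n + 3"] by simp
  have "[a = b] (mod 2)" "[collatz a = collatz b] (mod 4)"
    using cong_dvd_modulus_nat[OF Suc.prems, of 2] cong_dvd_modulus_nat[OF collatz, of 4]
    by (simp_all add: power_add)
  then show ?case
    using Suc.IH[OF collatz] by (auto simp: first_cut_Suc_Suc cong_def even_iff_mod_2_eq_zero)
qed

lemma first_cut_mod: "first_cut (Suc n) (a mod 2 ^ (n + 3)) \<longleftrightarrow> first_cut (Suc n) a"
  by (rule first_cut_cong) simp

lemma mod4_eq_Suc_0_iff: "a mod 4 = Suc 0 \<longleftrightarrow> odd a \<and> even (collatz a)" for a :: nat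
  unfolding collatz_def by presburger

lemma mod4_eq_3_iff: "a mod 4 = 3 \<longleftrightarrow> odd a \<and> odd (collatz a)" for a :: nat
  unfolding collatz_def by presburger

lemma mod4_mod: "(a mod 2 ^ (n + 3)) mod 4 = a mod 4" for a :: nat
  by (simp add: mod_mod_cancel power_add)

lemma even_mod: "even (a mod 2 ^ (n + 3)) \<longleftrightarrow> even a" for a :: nat
  by (simp add: power_add dvd_mod_iff)

text \<open>The three counts are proved by simultaneous induction with \<open>r = Suc n\<close>.
  Adding \<open>1\<close> to the third turns its recursion into the Fibonacci one and avoids
  truncated subtraction.\<close>

lemma card_first_cut:
  fixes n :: nat
  defines "M \<equiv> 2 ^ (n + 3)"
  shows "card {a. a < M \<and> even a \<and> first_cut (Suc n) a} = fib (Suc n)"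
    and "card {a. a < M \<and> a mod 4 = 1 \<and> first_cut (Suc n) a} = fib n"
    and "Suc (card {a. a < M \<and> a mod 4 = 3 \<and> first_cut (Suc n) a}) = fib (Suc n)"
  unfolding M_def
proof (induction n)
  case 0
  {
    case 1
    have "{a::nat. a < 2 ^ (0 + 3) \<and> even a \<and> first_cut (Suc 0) a} = {6}"
      by (auto simp: first_cut_1_iff)
    then show ?case by simp
  next
    case 2
    have "{a::nat. a < 2 ^ (0 + 3) \<and> a mod 4 = 1 \<and> first_cut (Suc 0) a} = {}"
      by (auto simp: first_cut_1 mod4_eq_Suc_0_iff)
    then show ?case by simp
  next
    case 3
    have "{a::nat. a < 2 ^ (0 + 3) \<and> a mod 4 = 3 \<and> first_cut (Suc 0) a} = {}"
      by (auto simp: first_cut_1 mod4_eq_3_iff)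
    then show ?case by simp
  }
next
  case (Suc n)
  have exp: "(2::nat) ^ (Suc n + 3) = 2 ^ Suc (n + 3)" by simp
  {
    case 1
    \<comment> \<open>For even \<open>a\<close>, the absence of a cut at time \<open>1\<close>
      excludes exactly the images that are \<open>3\<close> modulo \<open>4\<close>.\<close>
    let ?P = "\<lambda>b. b mod 4 \<noteq> 3 \<and> first_cut (Suc n) b"
    have "{a. a < 2 ^ (Suc n + 3) \<and> even a \<and> first_cut (Suc (Suc n)) a}
        = {a. a < 2 ^ Suc (n + 3) \<and> even a \<and> ?P (collatz a)}"
      unfolding exp by (auto simp: first_cut_Suc_Suc)
    moreover have "{b. b < 2 ^ (n + 3) \<and> ?P b}
        = {b. b < 2 ^ (n + 3) \<and> even b \<and> first_cut (Suc n) b}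
          \<union> {b. b < 2 ^ (n + 3) \<and> b mod 4 = 1 \<and> first_cut (Suc n) b}"
      by (auto simp: mod4_eq_Suc_0_iff mod4_eq_3_iff)
    moreover have "card \<dots> = fib (Suc n) + fib n"
      by (subst card_Un_disjoint) (use Suc.IH(1,2) in \<open>auto simp: mod4_eq_Suc_0_iff\<close>)
    ultimately show ?case
      using card_even_collatz[of "n + 3" ?P] by simp
  next
    case 2
    \<comment> \<open>An odd \<open>a\<close> has no cut at time \<open>1\<close>, so only the
      parity of the image is constrained.\<close>
    let ?P = "\<lambda>b. even b \<and> first_cut (Suc n) b"
    have "{a. a < 2 ^ (Suc n + 3) \<and> a mod 4 = 1 \<and> first_cut (Suc (Suc n)) a}
        = {a. a < 2 ^ Suc (n + 3) \<and> odd a \<and> ?P (collatz a)}"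
      unfolding exp by (auto simp: first_cut_Suc_Suc mod4_eq_Suc_0_iff)
    then show ?case
      using card_odd_collatz[of ?P "n + 3"] Suc.IH(1) by (simp add: even_mod first_cut_mod)
  next
    case 3
    let ?P = "\<lambda>b. odd b \<and> first_cut (Suc n) b"
    have "{a. a < 2 ^ (Suc n + 3) \<and> a mod 4 = 3 \<and> first_cut (Suc (Suc n)) a}
        = {a. a < 2 ^ Suc (n + 3) \<and> odd a \<and> ?P (collatz a)}"
      unfolding exp by (auto simp: first_cut_Suc_Suc mod4_eq_3_iff)
    moreover have "{b. b < 2 ^ (n + 3) \<and> ?P b}
        = {b. b < 2 ^ (n + 3) \<and> b mod 4 = 1 \<and> first_cut (Suc n) b}
          \<union> {b. b < 2 ^ (n + 3) \<and> b mod 4 = 3 \<and> first_cut (Suc n) b}"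
      by (auto simp: mod4_eq_Suc_0_iff mod4_eq_3_iff)
    moreover have "Suc (card \<dots>) = fib (Suc n) + fib n"
      by (subst card_Un_disjoint) (use Suc.IH(2,3) in \<open>auto simp: mod4_eq_Suc_0_iff mod4_eq_3_iff\<close>)
    ultimately show ?case
      using card_odd_collatz[of ?P "n + 3"] by (simp add: even_mod first_cut_mod)
  }
qed

text \<open>Since \<open>12 * 2 ^ Suc n = 3 * 2 ^ (n + 3)\<close>, the modulus splits into
  \<open>3\<close> and the power of two that decides the first cut; the condition modulo
  \<open>4\<close> goes with the latter.\<close>

lemma union_of_exactly_first_cut:
  "union_of_exactly {s. s > 0 \<and> [s = c] (mod 12) \<and> cut_time s = enat (Suc n)}
     (card {a. a < 2 ^ (n + 3) \<and> a mod 4 = c mod 4 \<and> first_cut (Suc n) a}) (12 * 2 ^ Suc n)"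
proof -
  let ?M = "2 ^ (n + 3) :: nat"
  let ?Q = "\<lambda>a. a mod 4 = c mod 4 \<and> first_cut (Suc n) a"
  let ?P = "\<lambda>a. [a = c] (mod 3) \<and> ?Q a"
  have Q: "?Q (a mod ?M) \<longleftrightarrow> ?Q a" for a
    by (simp only: mod4_mod first_cut_mod)
  have P: "?P (a mod (3 * ?M)) \<longleftrightarrow> ?P a" for a
  proof -
    have "[a mod (3 * ?M) = c] (mod 3) \<longleftrightarrow> [a = c] (mod 3)"
      by (simp only: cong_def mod_mod_cancel[OF dvd_triv_left])
    moreover have "?Q (a mod (3 * ?M)) \<longleftrightarrow> ?Q a"
      using Q[of a] Q[of "a mod (3 * ?M)"] by (simp only: mod_mod_cancel[OF dvd_triv_right])
    ultimately show ?thesis by (simp only:)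
  qed
  have "[s = c] (mod 12) \<longleftrightarrow> [s = c] (mod 3) \<and> s mod 4 = c mod 4" for s
  proof -
    have "coprime (3::nat) 4" by (simp add: coprime_iff_gcd_eq_1 gcd_non_0_nat)
    then show ?thesis
      using coprime_cong_mult_nat[of s c 3 4] cong_modulus_mult_nat[of s c 3 4]
        cong_modulus_mult_nat[of s c 4 3]
      by (auto simp: cong_def[of s c 4])
  qed
  then have "{s. s > 0 \<and> [s = c] (mod 12) \<and> cut_time s = enat (Suc n)} = {s. s > 0 \<and> ?P s}"
    by (simp add: cut_time_eq_enat_iff)
  moreover have "12 * 2 ^ Suc n = 3 * ?M"
    by (simp add: power_add)
  moreover have "union_of_exactly {s. s > 0 \<and> ?P s} (card {a. a < 3 * ?M \<and> ?P a}) (3 * ?M)"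
    by (rule union_of_exactly_periodic) (use P in simp_all)
  moreover have "card {a. a < 3 * ?M \<and> ?P a} = card {a. a < ?M \<and> ?Q a}"
    by (rule card_cong_periodic) (use Q in simp_all)
  ultimately show ?thesis by (simp only:)
qed

theorem corollary4p3:
  fixes c :: nat
  assumes "odd c"
  shows "([c = 1] (mod 4) \<longrightarrow>
           (\<forall>r\<ge>2. union_of_exactly
              {s. s > 0 \<and> [s = c] (mod 12) \<and> cut_time s = enat r}
              (fib (r - 1)) (12 * 2 ^ r)))
       \<and> ([c = 3] (mod 4) \<longrightarrow>
           (\<forall>r\<ge>3. union_of_exactly
              {s. s > 0 \<and> [s = c] (mod 12) \<and> cut_time s = enat r}
              (fib r - 1) (12 * 2 ^ r)))"
proof (intro conjI impI allI)
  fix r :: nat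
  assume "[c = 1] (mod 4)" "r \<ge> 2"
  moreover from this obtain n where "r = Suc n"
    by (cases r) auto
  ultimately show "union_of_exactly {s. s > 0 \<and> [s = c] (mod 12) \<and> cut_time s = enat r}
      (fib (r - 1)) (12 * 2 ^ r)"
    using union_of_exactly_first_cut[of c n] card_first_cut(2)[of n] by (simp add: cong_def)
next
  fix r :: nat
  assume "[c = 3] (mod 4)" "r \<ge> 3"
  moreover from this obtain n where "r = Suc n"
    by (cases r) auto
  \<comment> \<open>Rewriting \<open>fib (Suc n)\<close> as a successor resolves the subtraction in
    \<open>fib r - 1\<close>.\<close>
  ultimately show "union_of_exactly {s. s > 0 \<and> [s = c] (mod 12) \<and> cut_time s = enat r}
      (fib r - 1) (12 * 2 ^ r)"
    using union_of_exactly_first_cut[of c n] card_first_cut(3)[of n, symmetric]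
    by (simp add: cong_def)
qed

end
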